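(* Let $X$ be a metric space with integer valued metric. Let $A\in\mathscr A(X)$ and assume $1\le n:=\mathrm{rk}(A)<\infty$. Then: (1) the set $P(A)\subset H(A)\subset\mathbb{R}^X$ is an injective $n$-dimensional polytope (with respect to the sup-norm metric on $H(A)$); (2) the interior of $P(A)$ relative to $H(A)$ is the set $\{g\in\mathrm{E}'(X): A(g)=A\}$; (3) the faces of $P(A)$ are precisely the sets $P(A')$ with $A'\in\mathscr A(X)$ and $A\subset A'$.
   Context: For $f\colon X\to\mathbb{R}$, $A(f)$ is the set of unordered pairs $\{x,y\}$ ($x=y$ allowed) with $f(x)+f(y)=d(x,y)$. $\Delta(X)=\{f\in\mathbb R^X: f(x)+f(y)\ge d(x,y)\ \forall x,y\}$; $\mathrm{E}'(X)=\{f\in\Delta(X):\bigcup A(f)=X\}$; $\mathscr A(X)=\{A(f): f\in\mathrm{E}'(X)\}$; for $A\in\mathscr A(X)$, $H(A)=\{g\in\mathbb{R}^X: g(x)+g(y)=d(x,y)\ \forall \{x,y\}\in A\}$, $\mathrm{rk}(A)=\dim H(A)$, and $P(A)=\mathrm{E}'(X)\cap H(A)$. When $\mathrm{rk}(A)$ is finite, differences of elements of $H(A)$ are bounded and $H(A)$ is metrized by $\|g-h\|_\infty=\sup_x|g(x)-h(x)|$. Polytopes are convex and compact; a metric space is injective if 1-Lipschitz maps into it from subsets of metric spaces extend 1-Lipschitz. *)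

theory Defs
  imports "HOL-Analysis.Analysis" "HOL-Library.Function_Algebras"
begin

instantiation "fun" :: (type, real_vector) real_vector
begin
definition scaleR_fun :: "real \<Rightarrow> ('a \<Rightarrow> 'b) \<Rightarrow> 'a \<Rightarrow> 'b"
  where "scaleR_fun r f = (\<lambda>x. r *\<^sub>R f x)"
instance
  by standard (auto simp: scaleR_fun_def fun_eq_iff scaleR_add_right scaleR_add_left)
end

definition int_metric :: "('a \<Rightarrow> 'a \<Rightarrow> real) \<Rightarrow> bool" where
  "int_metric d \<longleftrightarrow> Metric_space UNIV d \<and> (\<forall>x y. d x y \<in> \<int>)"

definition Apairs :: "('a \<Rightarrow> 'a \<Rightarrow> real) \<Rightarrow> ('a \<Rightarrow> real) \<Rightarrow> 'a set set" where
  "Apairs d f = {{x, y} | x y. f x + f y = d x y}"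

definition Delta :: "('a \<Rightarrow> 'a \<Rightarrow> real) \<Rightarrow> ('a \<Rightarrow> real) set" where
  "Delta d = {f. \<forall>x y. f x + f y \<ge> d x y}"

definition Eprime :: "('a \<Rightarrow> 'a \<Rightarrow> real) \<Rightarrow> ('a \<Rightarrow> real) set" where
  "Eprime d = {f \<in> Delta d. \<Union>(Apairs d f) = UNIV}"

definition scrA :: "('a \<Rightarrow> 'a \<Rightarrow> real) \<Rightarrow> 'a set set set" where
  "scrA d = Apairs d ` Eprime d"

definition Hsp :: "('a \<Rightarrow> 'a \<Rightarrow> real) \<Rightarrow> 'a set set \<Rightarrow> ('a \<Rightarrow> real) set" where
  "Hsp d A = {g. \<forall>x y. {x, y} \<in> A \<longrightarrow> g x + g y = d x y}"

text \<open>Dimension of an (affine) subset S of the function space: dimension of the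
  linear span of its differences (= the direction of its affine hull).\<close>
definition affdim :: "('a \<Rightarrow> real) set \<Rightarrow> nat" where
  "affdim S = dim {g - h | g h. g \<in> S \<and> h \<in> S}"

definition rk :: "('a \<Rightarrow> 'a \<Rightarrow> real) \<Rightarrow> 'a set set \<Rightarrow> nat" where
  "rk d A = affdim (Hsp d A)"

definition fin_affdim :: "('a \<Rightarrow> real) set \<Rightarrow> bool" where
  "fin_affdim S \<longleftrightarrow> (\<exists>B. finite B \<and> span B = span {g - h | g h. g \<in> S \<and> h \<in> S})"

definition Ppol :: "('a \<Rightarrow> 'a \<Rightarrow> real) \<Rightarrow> 'a set set \<Rightarrow> ('a \<Rightarrow> real) set" where
  "Ppol d A = Eprime d \<inter> Hsp d A"

definition supdist :: "('a \<Rightarrow> real) \<Rightarrow> ('a \<Rightarrow> real) \<Rightarrow> real" where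
  "supdist g h = (SUP x. \<bar>g x - h x\<bar>)"

definition rel_int_in :: "('b \<Rightarrow> 'b \<Rightarrow> real) \<Rightarrow> 'b set \<Rightarrow> 'b set \<Rightarrow> 'b set" where
  "rel_int_in \<delta> T S = {g \<in> S. \<exists>\<epsilon>>0. \<forall>h\<in>T. \<delta> g h < \<epsilon> \<longrightarrow> h \<in> S}"

text \<open>Injectivity of the metric space (S, delta): every 1-Lipschitz map from a
  subset Z of a metric space (Y, e) into S extends to a 1-Lipschitz map Y \<rightarrow> S.
  The metric spaces (Y, e) range over carriers in the type 'b; a theorem with a
  free type variable 'b quantifies over all types, hence over all metric spaces.\<close>
definition injective_ms :: "'b itself \<Rightarrow> 'c set \<Rightarrow> ('c \<Rightarrow> 'c \<Rightarrow> real) \<Rightarrow> bool" where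
  "injective_ms _ S \<delta> \<longleftrightarrow>
     (\<forall>(Y::'b set) e Z \<phi>. Metric_space Y e \<and> Z \<subseteq> Y \<and> \<phi> ` Z \<subseteq> S \<and>
        (\<forall>x\<in>Z. \<forall>y\<in>Z. \<delta> (\<phi> x) (\<phi> y) \<le> e x y) \<longrightarrow>
        (\<exists>\<psi>. \<psi> ` Y \<subseteq> S \<and> (\<forall>x\<in>Z. \<psi> x = \<phi> x) \<and>
             (\<forall>x\<in>Y. \<forall>y\<in>Y. \<delta> (\<psi> x) (\<psi> y) \<le> e x y)))"

end

theory Submission
  imports Defs
begin

text \<open>The directions of \<open>Hsp d A\<close> are the functions changing sign along every edge of the graph \<open>A\<close>:
  they vanish on components with an odd closed walk and are constant up to sign on the others. Finite
  rank means that only finitely many components have no odd closed walk; since \<open>d\<close> is integral,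
  for fixed \<open>g\<close> in \<open>Hsp d A\<close> the values of \<open>g x + g y - d x y\<close> lie in finitely many cosets of the
  half-integers, so the positive ones are bounded away from 0. This gap makes the infinitely many
  defining inequalities behave like finitely many: points with \<open>Apairs d g = A\<close> are interior, and a
  ray leaving \<open>Delta d\<close> exits where a new pair becomes tight. Induction on the rank shows that
  \<open>Ppol d A\<close> is the hull of its rank 0 points, which are half-integral and bounded, hence finite in
  number. A face is determined by its point of largest rank. Injectivity uses that each
  inequality involves just two coordinates.\<close>

section \<open>Direction spaces and finite sets of coordinates that determine them\<close>

definition Dir :: "'a set set \<Rightarrow> ('a \<Rightarrow> real) set" where
  "Dir A = {v. \<forall>x y. {x, y} \<in> A \<longrightarrow> v x + v y = 0}"

text \<open>For a subspace \<open>W\<close> this says that evaluation on the finite set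
  \<open>S\<close> is injective on \<open>W\<close>. It is the working form of finite rank: it
  passes to subsets and supplies finitely many coordinates for estimates.\<close>

definition determining :: "'a set \<Rightarrow> ('a \<Rightarrow> real) set \<Rightarrow> bool" where
  "determining S W \<longleftrightarrow> finite S \<and> (\<forall>v\<in>W. (\<forall>s\<in>S. v s = 0) \<longrightarrow> v = 0)"

lemma DirD: "v \<in> Dir A \<Longrightarrow> {x, y} \<in> A \<Longrightarrow> v x + v y = 0"
  by (simp add: Dir_def)

lemma subspace_Dir: "subspace (Dir A)"
  by (auto simp: subspace_def Dir_def scaleR_fun_def simp flip: distrib_left) (smt (verit))

lemma Dir_antimono: "A \<subseteq> A' \<Longrightarrow> Dir A' \<subseteq> Dir A"
  by (auto simp: Dir_def)

lemma determining_mono: "determining S W \<Longrightarrow> U \<subseteq> W \<Longrightarrow> determining S U"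
  by (auto simp: determining_def)

text \<open>A new generator adds at most one dimension. If \<open>S\<close> no longer suffices, the
  elements vanishing on \<open>S\<close> are the multiples of one \<open>v\<close>, and one
  coordinate with \<open>v x \<noteq> 0\<close> detects them.\<close>

lemma finite_span_determining:
  fixes B :: "('a \<Rightarrow> real) set"
  assumes "finite B"
  shows "\<exists>S. determining S (span B)"
  using assms
proof (induction B)
  case empty
  then show ?case by (auto simp: determining_def)
next
  case (insert b B)
  then obtain S where S: "determining S (span B)" by blast
  show ?case
  proof (cases "determining S (span (insert b B))")
    case False
    then obtain v where v: "v \<in> span (insert b B)" "\<forall>s\<in>S. v s = 0" "v \<noteq> 0"
      using S by (auto simp: determining_def)
    then obtain x where x: "v x \<noteq> 0" by (auto simp: fun_eq_iff)
    obtain l where l: "v - l *\<^sub>R b \<in> span B" using v(1) span_breakdown_eq by blast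
    have "l \<noteq> 0" using l v S by (auto simp: determining_def)
    have "w = 0" if w: "w \<in> span (insert b B)" "\<forall>s\<in>insert x S. w s = 0" for w
    proof -
      obtain k where k: "w - k *\<^sub>R b \<in> span B" using w(1) span_breakdown_eq by blast
      \<comment> \<open>The factor \<open>k / l\<close> cancels \<open>b\<close>, so the remainder
        stays in \<open>span B\<close>, where \<open>S\<close> is determining.\<close>
      have "(w - k *\<^sub>R b) - (k / l) *\<^sub>R (v - l *\<^sub>R b) \<in> span B"
        by (intro span_diff span_scale k l)
      also have "(w - k *\<^sub>R b) - (k / l) *\<^sub>R (v - l *\<^sub>R b) = w - (k / l) *\<^sub>R v"
        using \<open>l \<noteq> 0\<close> by (simp add: algebra_simps)
      finally have "w - (k / l) *\<^sub>R v \<in> span B" .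
      moreover have "\<forall>s\<in>S. (w - (k / l) *\<^sub>R v) s = 0"
        using v(2) w(2) by (simp add: scaleR_fun_def)
      ultimately have "w - (k / l) *\<^sub>R v = 0"
        using S unfolding determining_def by blast
      then have eq: "w = (k / l) *\<^sub>R v" by (simp only: right_minus_eq)
      have "w x = 0" using w(2) by simp
      then have "k / l * v x = 0" using fun_cong[OF eq, of x] by (simp add: scaleR_fun_def)
      then show ?thesis using eq x by auto
    qed
    then have "determining (insert x S) (span (insert b B))"
      using S by (auto simp: determining_def)
    then show ?thesis by blast
  qed blast
qed

text \<open>\<open>dim\<close> is the cardinality of a basis, which would be 0 for an infinite one;
  the finite \<open>B\<close> excludes this. A basis of \<open>U\<close> together with a vector of
  \<open>W\<close> outside \<open>U\<close> extends to a finite basis of \<open>W\<close>.\<close>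

lemma dim_strict_mono:
  fixes U W :: "('b :: real_vector) set"
  assumes "subspace U" "subspace W" "U \<subset> W" "W \<subseteq> span B" "finite B"
  shows "dim U < dim W"
proof -
  obtain C where C: "C \<subseteq> U" "independent C" "U \<subseteq> span C" "card C = dim U"
    using basis_exists by blast
  obtain w where w: "w \<in> W" "w \<notin> U" using assms by blast
  have "span C \<subseteq> U" using C assms by (simp add: span_minimal)
  then have wn: "w \<notin> span C" using w by blast
  then have ind: "independent (insert w C)"
    using C independent_insertI by blast
  obtain E where E: "insert w C \<subseteq> E" "E \<subseteq> W" "independent E" "W \<subseteq> span E"
    using maximal_independent_subset_extend[OF _ ind, of W] C w assms by blast
  have fE: "finite E" using independent_span_bound[OF assms(5) E(3)] E assms by blast
  have "w \<notin> C" using wn span_base by blast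
  then have "card C < card (insert w C)" using fE E(1) finite_subset[of C E] by simp
  also have "\<dots> \<le> card E" using fE E(1) by (rule card_mono)
  also have "card E = dim W" using E by (simp add: dim_unique)
  finally show ?thesis using C by simp
qed

section \<open>Walks with parity and boundedness of directions\<close>

text \<open>The flag records the parity: \<open>True\<close> for walks of even length.\<close>
inductive walk :: "'a set set \<Rightarrow> bool \<Rightarrow> 'a \<Rightarrow> 'a \<Rightarrow> bool" for A where
  walk_refl: "walk A True x x"
| walk_step: "walk A b x y \<Longrightarrow> {y, z} \<in> A \<Longrightarrow> walk A (\<not> b) x z"

lemma walk_edge_iff:
  assumes "{y, z} \<in> A"
  shows "walk A b x y \<longleftrightarrow> walk A (\<not> b) x z"
  using walk_step[of A b x y z] walk_step[of A "\<not> b" x z y] assms by (auto simp: insert_commute)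

lemma walk_Dir:
  assumes "walk A b x y" "v \<in> Dir A"
  shows "v y = (if b then v x else - v x)"
  using assms by induction (auto dest: DirD split: if_splits)

text \<open>Each edge contributes an integer \<open>d y z\<close>. An odd closed walk at
  \<open>x\<close> thus gives \<open>2 * g x \<in> \<int>\<close>, the source of the
  half-integers.\<close>

lemma walk_Hsp_Ints:
  assumes "walk A b x y" "g \<in> Hsp d A" "int_metric d"
  shows "g y - (if b then g x else - g x) \<in> \<int>"
  using assms
proof induction
  case (walk_step b x y z)
  have "g y + g z = d y z" using walk_step by (auto simp: Hsp_def)
  then have "g z - (if \<not> b then g x else - g x) = d y z - (g y - (if b then g x else - g x))"
    by auto
  moreover have "d y z \<in> \<int>" using walk_step by (auto simp: int_metric_def)
  ultimately show ?case using walk_step by (metis Ints_diff)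
qed simp

text \<open>On a component without odd closed walk this is 1 or -1 according to the parity of walks
  from \<open>x\<close>, and 0 off the component. If the component of \<open>x\<close> has an odd
  closed walk, the two terms cancel everywhere.\<close>

definition component_vec :: "'a set set \<Rightarrow> 'a \<Rightarrow> 'a \<Rightarrow> real" where
  "component_vec A x y = of_bool (walk A True x y) - of_bool (walk A False x y)"

lemma component_vec_Dir: "component_vec A x \<in> Dir A"
  using walk_edge_iff[of _ _ A True x] walk_edge_iff[of _ _ A False x]
  by (auto simp: Dir_def component_vec_def)

lemma component_vec_self: "\<not> walk A False x x \<Longrightarrow> component_vec A x x = 1"
  by (simp add: component_vec_def walk_refl)

text \<open>Otherwise \<open>component_vec A x\<close> would be a nonzero direction vanishing on
  \<open>S\<close>.\<close>

lemma determining_walk: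
  assumes "determining S (Dir A)"
  shows "walk A False x x \<or> (\<exists>s\<in>S. \<exists>b. walk A b x s)"
proof (rule ccontr)
  assume n: "\<not> ?thesis"
  then have "\<forall>s\<in>S. component_vec A x s = 0" by (auto simp: component_vec_def)
  then have "component_vec A x = 0"
    using assms component_vec_Dir[of A x] by (auto simp: determining_def)
  then show False using n component_vec_self[of A x] by (auto simp: fun_eq_iff)
qed

text \<open>Absolute values of a direction are constant along walks, so each is 0 or occurs on the
  finite set \<open>S\<close>.\<close>

lemma Dir_bounded:
  assumes "determining S (Dir A)" "v \<in> Dir A"
  obtains M where "M > 0" "\<And>x. \<bar>v x\<bar> \<le> M"
proof
  \<comment> \<open>The summand 1 makes the bound positive even for \<open>v = 0\<close>, so that it
    can serve as a divisor.\<close>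
  show "(\<Sum>s\<in>S. \<bar>v s\<bar>) + 1 > 0" by (smt (verit) sum_nonneg)
  fix x
  have nn: "(\<Sum>s\<in>S. \<bar>v s\<bar>) \<ge> 0" by (simp add: sum_nonneg)
  consider "walk A False x x" | s b where "s \<in> S" "walk A b x s"
    using determining_walk[OF assms(1)] by blast
  then show "\<bar>v x\<bar> \<le> (\<Sum>s\<in>S. \<bar>v s\<bar>) + 1"
  proof cases
    case 1
    then have "v x = 0" using walk_Dir[OF _ assms(2), of False x x] by auto
    then show ?thesis using nn by simp
  next
    case 2
    then have "\<bar>v x\<bar> = \<bar>v s\<bar>" using walk_Dir[OF 2(2) assms(2)] by (auto split: if_splits)
    moreover have "\<bar>v s\<bar> \<le> (\<Sum>s\<in>S. \<bar>v s\<bar>)"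
      using assms 2 by (intro member_le_sum) (auto simp: determining_def)
    ultimately show ?thesis by simp
  qed
qed

section \<open>The positive gap obtained from integrality\<close>

lemma finite_residues_gap:
  fixes R :: "real set"
  assumes "finite R"
  shows "\<exists>\<epsilon>>0. \<forall>t>0. (\<exists>r\<in>R. t - r \<in> \<int>) \<longrightarrow> \<epsilon> \<le> t"
proof -
  \<comment> \<open>A nonintegral \<open>t > 0\<close> is at least its fractional part; the element
    1 handles the integral ones.\<close>
  define E where "E = insert 1 {frac r |r. r \<in> R \<and> frac r > 0}"
  have fE: "finite E" using assms by (auto simp: E_def)
  have "Min E > 0" using fE by (subst Min_gr_iff) (auto simp: E_def)
  moreover have "Min E \<le> t" if t: "t > 0" "r \<in> R" "t - r \<in> \<int>" for t r
  proof -
    obtain k where k: "t - r = of_int k" using t(3) by (elim Ints_cases)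
    have fr: "frac t = frac r" using k by (metis add.commute diff_add_cancel frac_add_of_int_left)
    show ?thesis
    proof (cases "frac r > 0")
      case True
      then have "Min E \<le> frac r" using fE t by (intro Min_le) (auto simp: E_def)
      moreover have "frac t \<le> t" using t(1) by (simp add: frac_def)
      ultimately show ?thesis using fr by simp
    next
      case False
      then have "t \<in> \<int>" using fr frac_ge_0[of r] frac_eq_0_iff[of t] by linarith
      then have "1 \<le> t" using t(1) by (auto elim!: Ints_cases)
      moreover have "Min E \<le> 1" using fE by (intro Min_le) (auto simp: E_def)
      ultimately show ?thesis by simp
    qed
  qed
  ultimately show ?thesis by blast
qed

lemma Hsp_gap:
  assumes "int_metric d" "g \<in> Hsp d A" "determining S (Dir A)"
  shows "\<exists>\<epsilon>>0. \<forall>x y. d x y < g x + g y \<longrightarrow> d x y + \<epsilon> \<le> g x + g y"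
proof -
  \<comment> \<open>Representatives modulo 1 of all values \<open>2 * g x\<close>: 0 for points on
    an odd closed walk, the others for points joined to \<open>S\<close>. Doubling is forced by the
    first kind.\<close>
  define R where "R = insert 0 ((\<lambda>s. 2 * g s) ` S \<union> (\<lambda>s. - 2 * g s) ` S)"
  have fR: "finite R" using assms by (auto simp: R_def determining_def)
  have res: "\<exists>r\<in>R. 2 * g x - r \<in> \<int>" for x
  proof -
    consider "walk A False x x" | s b where "s \<in> S" "walk A b x s"
      using determining_walk[OF assms(3)] by blast
    then show ?thesis
    proof cases
      case 1
      then have "2 * g x - 0 \<in> \<int>" using walk_Hsp_Ints[OF _ assms(2,1), of False x x] by simp
      then show ?thesis by (intro bexI[of _ 0]) (auto simp: R_def)
    next
      case 2
      have i: "2 * (g s - (if b then g x else - g x)) \<in> \<int>"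
        using walk_Hsp_Ints[OF 2(2) assms(2,1)] by (intro Ints_mult) auto
      show ?thesis
      proof (cases b)
        case True
        then have "2 * g x - 2 * g s \<in> \<int>" using Ints_minus[OF i] by (simp add: algebra_simps)
        then show ?thesis using 2 by (intro bexI[of _ "2 * g s"]) (auto simp: R_def)
      next
        case False
        then have "2 * g x - (- 2 * g s) \<in> \<int>" using i by (simp add: algebra_simps)
        then show ?thesis using 2 by (intro bexI[of _ "- 2 * g s"]) (auto simp: R_def)
      qed
    qed
  qed
  define R2 where "R2 = (\<lambda>(r, r'). r + r') ` (R \<times> R)"
  have "finite R2" using fR by (simp add: R2_def)
  then obtain \<epsilon> where e: "\<epsilon> > 0" "\<And>t r. t > 0 \<Longrightarrow> r \<in> R2 \<Longrightarrow> t - r \<in> \<int> \<Longrightarrow> \<epsilon> \<le> t"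
    using finite_residues_gap by metis
  have "d x y + \<epsilon> / 2 \<le> g x + g y" if "d x y < g x + g y" for x y
  proof -
    obtain r r' where r: "r \<in> R" "r' \<in> R" "2 * g x - r \<in> \<int>" "2 * g y - r' \<in> \<int>"
      using res by meson
    have "d x y \<in> \<int>" using assms(1) by (auto simp: int_metric_def)
    then have "(2 * g x - r) + (2 * g y - r') - (d x y + d x y) \<in> \<int>"
      using r(3,4) by (blast intro: Ints_diff Ints_add)
    then have "2 * (g x + g y - d x y) - (r + r') \<in> \<int>" by (simp add: algebra_simps)
    then have "\<epsilon> \<le> 2 * (g x + g y - d x y)" using that r by (intro e(2)) (auto simp: R2_def)
    then show ?thesis by simp
  qed
  then show ?thesis using e(1) by (intro exI[of _ "\<epsilon> / 2"]) auto
qed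

section \<open>Tight pairs and the affine spaces they define\<close>

lemma int_metric_sym: "int_metric d \<Longrightarrow> d x y = d y x"
  by (auto simp: int_metric_def Metric_space.commute)

lemma Delta_iff: "f \<in> Delta d \<longleftrightarrow> (\<forall>x y. d x y \<le> f x + f y)"
  by (simp add: Delta_def)

lemma Apairs_iff:
  assumes "int_metric d"
  shows "{x, y} \<in> Apairs d f \<longleftrightarrow> f x + f y = d x y"
  using int_metric_sym[OF assms] by (auto simp: Apairs_def doubleton_eq_iff)

lemma Apairs_subset_iff:
  "Apairs d f \<subseteq> A \<longleftrightarrow> (\<forall>x y. f x + f y = d x y \<longrightarrow> {x, y} \<in> A)"
  by (auto simp: Apairs_def)

lemma Hsp_Apairs_iff:
  assumes "int_metric d"
  shows "g \<in> Hsp d (Apairs d f) \<longleftrightarrow> Apairs d f \<subseteq> Apairs d g"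
  using Apairs_iff[OF assms] by (simp add: Hsp_def Apairs_subset_iff)

text \<open>Covering all points is inherited by larger sets of tight pairs, so only the inequalities
  of \<open>Delta d\<close> remain to be required.\<close>

lemma Ppol_Apairs:
  assumes "int_metric d" "f \<in> Eprime d"
  shows "Ppol d (Apairs d f) = {g \<in> Delta d. Apairs d f \<subseteq> Apairs d g}"
proof -
  have "g \<in> Eprime d" if "g \<in> Delta d" "Apairs d f \<subseteq> Apairs d g" for g
    using that assms(2) unfolding Eprime_def by blast
  then show ?thesis
    unfolding Ppol_def by (auto simp: Hsp_Apairs_iff[OF assms(1)]) (simp add: Eprime_def)
qed

lemma Hsp_diff_Dir: "g \<in> Hsp d A \<Longrightarrow> h \<in> Hsp d A \<Longrightarrow> g - h \<in> Dir A"
  by (force simp: Hsp_def Dir_def algebra_simps)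

lemma Hsp_add_Dir: "g \<in> Hsp d A \<Longrightarrow> v \<in> Dir A \<Longrightarrow> g + v \<in> Hsp d A"
  by (force simp: Hsp_def Dir_def algebra_simps)

lemma Hsp_differences:
  assumes "f \<in> Hsp d A"
  shows "{g - h | g h. g \<in> Hsp d A \<and> h \<in> Hsp d A} = Dir A"
proof -
  have "\<exists>g h. v = g - h \<and> g \<in> Hsp d A \<and> h \<in> Hsp d A" if "v \<in> Dir A" for v
    using that assms by (intro exI[of _ "f + v"] exI[of _ f]) (auto intro: Hsp_add_Dir)
  then show ?thesis by (auto intro: Hsp_diff_Dir)
qed

section \<open>Room for small perturbations\<close>

text \<open>Directions keep tight pairs tight, while every other pair has slack at least the gap, of
  which each of its two coordinates may consume half.\<close>

lemma Delta_interior: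
  assumes "int_metric d" "f \<in> Delta d" "determining S (Dir (Apairs d f))"
  shows "\<exists>\<epsilon>>0. \<forall>v\<in>Dir (Apairs d f). (\<forall>x. \<bar>v x\<bar> \<le> \<epsilon>) \<longrightarrow> f + v \<in> Delta d"
proof -
  have "f \<in> Hsp d (Apairs d f)" by (simp add: Hsp_Apairs_iff[OF assms(1)])
  then obtain \<epsilon> where e: "\<epsilon> > 0" "\<And>x y. d x y < f x + f y \<Longrightarrow> d x y + \<epsilon> \<le> f x + f y"
    using Hsp_gap assms by metis
  have "d x y \<le> (f + v) x + (f + v) y"
    if v: "v \<in> Dir (Apairs d f)" "\<And>x. \<bar>v x\<bar> \<le> \<epsilon> / 2" for v x y
  proof (cases "f x + f y = d x y")
    case True
    then have "v x + v y = 0" using DirD[OF v(1)] Apairs_iff[OF assms(1)] by blast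
    then show ?thesis using True by simp
  next
    case False
    then have "d x y + \<epsilon> \<le> f x + f y" using e(2) assms(2) by (simp add: Delta_iff order_less_le)
    then show ?thesis using v(2)[of x] v(2)[of y] by auto
  qed
  then show ?thesis using e(1) by (intro exI[of _ "\<epsilon> / 2"]) (auto simp: Delta_iff)
qed

lemma Delta_wiggle:
  assumes "int_metric d" "f \<in> Delta d" "determining S (Dir (Apairs d f))" "v \<in> Dir (Apairs d f)"
  obtains \<delta> where "\<delta> > 0" "\<And>t. \<bar>t\<bar> \<le> \<delta> \<Longrightarrow> f + t *\<^sub>R v \<in> Delta d"
proof -
  obtain \<epsilon> where e: "\<epsilon> > 0"
    "\<And>v. v \<in> Dir (Apairs d f) \<Longrightarrow> (\<forall>x. \<bar>v x\<bar> \<le> \<epsilon>) \<Longrightarrow> f + v \<in> Delta d"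
    using Delta_interior assms by metis
  obtain M where M: "M > 0" "\<And>x. \<bar>v x\<bar> \<le> M" using Dir_bounded assms by metis
  show thesis
  proof
    show "\<epsilon> / M > 0" using e M by simp
    fix t :: real assume t: "\<bar>t\<bar> \<le> \<epsilon> / M"
    have "\<bar>(t *\<^sub>R v) x\<bar> \<le> \<epsilon>" for x
    proof -
      have "\<bar>t\<bar> * \<bar>v x\<bar> \<le> \<epsilon> / M * M" using t M e by (intro mult_mono) auto
      then show ?thesis using M by (simp add: scaleR_fun_def abs_mult)
    qed
    then show "f + t *\<^sub>R v \<in> Delta d"
      using e(2) subspace_scale[OF subspace_Dir assms(4)] by blast
  qed
qed

section \<open>Rays leaving the set of admissible functions\<close>

lemma Delta_nonneg:
  assumes "int_metric d" "f \<in> Delta d"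
  shows "0 \<le> f x"
proof -
  have "d x x = 0" using assms(1) by (simp add: int_metric_def Metric_space.mdist_zero[of UNIV])
  then show ?thesis using assms(2) by (metis Delta_iff add_neg_neg not_less)
qed

lemma Eprime_partner:
  assumes "f \<in> Eprime d" "int_metric d"
  obtains y where "f x + f y = d x y"
proof -
  have "x \<in> \<Union>(Apairs d f)" using assms by (simp add: Eprime_def)
  then obtain a b where "x \<in> {a, b}" "f a + f b = d a b" by (auto simp: Apairs_def)
  then show thesis using that int_metric_sym[OF assms(2)] by (auto simp: add.commute)
qed

text \<open>The ray stops at a point of \<open>Delta d\<close> where a new pair becomes tight, as by the gap of
  \<open>Delta_interior\<close> it could be prolonged otherwise.\<close>
lemma ray_exit:
  assumes "int_metric d" "f \<in> Eprime d" "determining S (Dir (Apairs d f))"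
    "v \<in> Dir (Apairs d f)" "v \<noteq> 0"
  obtains t where "t > 0" "f + t *\<^sub>R v \<in> Delta d" "Apairs d f \<subseteq> Apairs d (f + t *\<^sub>R v)"
    "v \<notin> Dir (Apairs d (f + t *\<^sub>R v))"
proof -
  have fD: "f \<in> Delta d" using assms by (simp add: Eprime_def)
  define T where "T = {t. 0 \<le> t \<and> f + t *\<^sub>R v \<in> Delta d}"
  obtain x where x: "v x \<noteq> 0" using assms(5) by (auto simp: fun_eq_iff)
  obtain y where y: "f x + f y = d x y" using Eprime_partner assms by metis
  then have vy: "v x + v y = 0" using DirD[OF assms(4)] Apairs_iff[OF assms(1)] by blast
  \<comment> \<open>Along \<open>v\<close> one of the coordinates \<open>x\<close>, \<open>y\<close>
    decreases at rate \<open>\<bar>v x\<bar>\<close>, and both must stay nonnegative.\<close>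
  have bound: "t \<le> (f x + f y) / \<bar>v x\<bar>" if "t \<in> T" for t
  proof -
    have "0 \<le> f x + t * v x" "0 \<le> f y + t * v y"
      using Delta_nonneg[OF assms(1), of "f + t *\<^sub>R v"] that
      by (auto simp: T_def scaleR_fun_def)
    moreover have "0 \<le> f x" "0 \<le> f y" using Delta_nonneg[OF assms(1) fD] by auto
    moreover have "v y = - v x" using vy by simp
    ultimately have "t * \<bar>v x\<bar> \<le> f x + f y" by (auto simp: abs_if)
    then show ?thesis using x by (simp add: pos_le_divide_eq)
  qed
  then have bdd: "bdd_above T" by (auto simp: bdd_above_def)
  obtain \<delta> where "\<delta> > 0" "\<And>t. \<bar>t\<bar> \<le> \<delta> \<Longrightarrow> f + t *\<^sub>R v \<in> Delta d"
    using Delta_wiggle[OF assms(1) fD assms(3,4)] by metis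
  then have dT: "\<delta> \<in> T" "\<delta> > 0" by (auto simp: T_def)
  define s where "s = Sup T"
  let ?g = "f + s *\<^sub>R v"
  have s0: "s > 0" using dT cSup_upper[OF dT(1) bdd] by (simp add: s_def)
  \<comment> \<open>The supremum is attained: each inequality either holds for all nonnegative times
    or is an upper bound on \<open>T\<close>, which passes to \<open>Sup T\<close>.\<close>
  have gD: "?g \<in> Delta d"
    unfolding Delta_iff
  proof (intro allI)
    fix a b
    have fab: "d a b \<le> f a + f b" using fD by (simp add: Delta_iff)
    show "d a b \<le> ?g a + ?g b"
    proof (cases "v a + v b \<ge> 0")
      case True
      then have "0 \<le> s * (v a + v b)" using s0 by simp
      then show ?thesis using fab by (simp add: scaleR_fun_def algebra_simps)
    next
      case False
      have "t \<le> (f a + f b - d a b) / (- (v a + v b))" if "t \<in> T" for t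
      proof -
        have "d a b \<le> f a + t * v a + (f b + t * v b)"
          using that by (auto simp: T_def Delta_iff scaleR_fun_def)
        then have "t * (- (v a + v b)) \<le> f a + f b - d a b" by (simp add: algebra_simps)
        then show ?thesis using False by (subst pos_le_divide_eq) auto
      qed
      then have "s \<le> (f a + f b - d a b) / (- (v a + v b))"
        unfolding s_def using dT by (intro cSup_least) auto
      then have "s * (- (v a + v b)) \<le> f a + f b - d a b"
        using False by (subst (asm) pos_le_divide_eq) auto
      then show ?thesis by (simp add: scaleR_fun_def algebra_simps)
    qed
  qed
  have sub: "Apairs d f \<subseteq> Apairs d ?g"
  proof -
    have "f \<in> Hsp d (Apairs d f)" by (simp add: Hsp_Apairs_iff[OF assms(1)])
    then show ?thesis
      using Hsp_add_Dir subspace_scale[OF subspace_Dir assms(4)] Hsp_Apairs_iff[OF assms(1)]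
      by metis
  qed
  have "v \<notin> Dir (Apairs d ?g)"
  proof
    assume v: "v \<in> Dir (Apairs d ?g)"
    obtain \<eta> where eta: "\<eta> > 0" "\<And>t. \<bar>t\<bar> \<le> \<eta> \<Longrightarrow> ?g + t *\<^sub>R v \<in> Delta d"
      using Delta_wiggle[OF assms(1) gD _ v]
        determining_mono[OF assms(3) Dir_antimono[OF sub]] by metis
    have "?g + \<eta> *\<^sub>R v \<in> Delta d" using eta by simp
    then have "s + \<eta> \<in> T" using s0 eta by (simp add: T_def algebra_simps)
    then show False using cSup_upper[OF _ bdd] eta by (fastforce simp: s_def)
  qed
  then show thesis using that[OF s0 gD sub] by blast
qed

section \<open>Convexity\<close>

lemma convex_Delta: "convex (Delta d)"
proof (rule convexI)
  fix g h :: "'a \<Rightarrow> real" and u v :: real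
  assume *: "g \<in> Delta d" "h \<in> Delta d" "0 \<le> u" "0 \<le> v" "u + v = 1"
  have "d x y \<le> u * (g x + g y) + v * (h x + h y)" for x y
  proof -
    have "u * d x y + v * d x y \<le> u * (g x + g y) + v * (h x + h y)"
      using * by (intro add_mono mult_left_mono) (auto simp: Delta_iff)
    moreover have "u * d x y + v * d x y = d x y"
      using * by (metis distrib_right mult_1)
    ultimately show ?thesis by simp
  qed
  then show "u *\<^sub>R g + v *\<^sub>R h \<in> Delta d" by (simp add: Delta_iff scaleR_fun_def algebra_simps)
qed

text \<open>The slack of a pair is a combination, with positive weights, of two nonnegative slacks,
  so it vanishes only if both do.\<close>

lemma Apairs_convex_combination:
  assumes "int_metric d" "g \<in> Delta d" "h \<in> Delta d" "0 < u" "u < 1"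
  shows "Apairs d ((1 - u) *\<^sub>R g + u *\<^sub>R h) = Apairs d g \<inter> Apairs d h"
proof -
  have iff: "((1 - u) *\<^sub>R g + u *\<^sub>R h) x + ((1 - u) *\<^sub>R g + u *\<^sub>R h) y = d x y
      \<longleftrightarrow> g x + g y = d x y \<and> h x + h y = d x y" for x y
  proof -
    have 1: "((1 - u) *\<^sub>R g + u *\<^sub>R h) x + ((1 - u) *\<^sub>R g + u *\<^sub>R h) y - d x y
      = (1 - u) * (g x + g y - d x y) + u * (h x + h y - d x y)"
      by (simp add: scaleR_fun_def algebra_simps)
    have "0 \<le> (1 - u) * (g x + g y - d x y)" "0 \<le> u * (h x + h y - d x y)"
      using assms by (auto simp: Delta_iff)
    then have "(1 - u) * (g x + g y - d x y) + u * (h x + h y - d x y) = 0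
      \<longleftrightarrow> g x + g y = d x y \<and> h x + h y = d x y"
      using assms by (subst add_nonneg_eq_0_iff) auto
    then show ?thesis using 1 by auto
  qed
  show ?thesis
  proof
    show "Apairs d ((1 - u) *\<^sub>R g + u *\<^sub>R h) \<subseteq> Apairs d g \<inter> Apairs d h"
      using iff by (auto simp: Apairs_def)
    have "\<exists>x y. e = {x, y}" if "e \<in> Apairs d g" for e using that by (auto simp: Apairs_def)
    then show "Apairs d g \<inter> Apairs d h \<subseteq> Apairs d ((1 - u) *\<^sub>R g + u *\<^sub>R h)"
      using iff Apairs_iff[OF assms(1)] by (smt (verit) IntE subsetI)
  qed
qed

lemma convex_Hsp: "convex (Hsp d A)"
proof (rule convexI)
  fix g h :: "'a \<Rightarrow> real" and u v :: real
  assume *: "g \<in> Hsp d A" "h \<in> Hsp d A" "0 \<le> u" "0 \<le> v" "u + v = 1"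
  have "u * (g x + g y) + v * (h x + h y) = d x y" if "{x, y} \<in> A" for x y
    using * that by (simp add: Hsp_def) (metis distrib_right mult_1)
  then show "u *\<^sub>R g + v *\<^sub>R h \<in> Hsp d A" by (simp add: Hsp_def scaleR_fun_def algebra_simps)
qed

lemma Ppol_eq:
  assumes "int_metric d" "A \<in> scrA d"
  shows "Ppol d A = Delta d \<inter> Hsp d A"
  using assms Ppol_Apairs[OF assms(1)] Hsp_Apairs_iff[OF assms(1)] by (auto simp: scrA_def)

lemma convex_Ppol: "int_metric d \<Longrightarrow> A \<in> scrA d \<Longrightarrow> convex (Ppol d A)"
  by (simp add: Ppol_eq convex_Int convex_Delta convex_Hsp)

section \<open>Vertices and the convex hull\<close>

text \<open>Without nonzero directions every \<open>component_vec\<close> vanishes, so every point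
  has an odd closed walk.\<close>

lemma vertex_half_integral:
  assumes "int_metric d" "Dir (Apairs d g) = {0}"
  shows "2 * g x \<in> \<int>"
proof -
  have "component_vec (Apairs d g) x = 0" using component_vec_Dir[of "Apairs d g" x] assms(2) by (metis singletonD)
  then have "walk (Apairs d g) False x x"
    using component_vec_self[of "Apairs d g" x] by (auto simp: fun_eq_iff)
  moreover have "g \<in> Hsp d (Apairs d g)" by (simp add: Hsp_Apairs_iff[OF assms(1)])
  ultimately show ?thesis using walk_Hsp_Ints[of _ False x x g d] assms by simp
qed

text \<open>Elements of \<open>Ppol d A\<close> are determined by their restriction to
  \<open>S\<close>, and a vertex takes only finitely many values at each point of
  \<open>S\<close>.\<close>

lemma finite_vertices:
  assumes "int_metric d" "A \<in> scrA d" "determining S (Dir A)"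
  shows "finite {g \<in> Ppol d A. Dir (Apairs d g) = {0}}" (is "finite ?V")
proof -
  obtain f where f: "f \<in> Eprime d" "A = Apairs d f" using assms by (auto simp: scrA_def)
  obtain p where p: "\<And>x. f x + f (p x) = d x (p x)" proof -
    have "\<forall>x. \<exists>y. f x + f y = d x y" using Eprime_partner[OF f(1) assms(1)] by metis
    then show thesis using that by metis
  qed
  \<comment> \<open>Half-integers from 0 to \<open>d s (p s)\<close>: the tight partner
    \<open>p s\<close> also has a nonnegative value. The ceiling only converts an integral real to
    type \<open>int\<close>.\<close>
  define K where "K s = (\<lambda>k::int. of_int k / 2 :: real) ` {0..\<lceil>2 * d s (p s)\<rceil>}" for s
  have fS: "finite S" using assms by (simp add: determining_def)
  have inj: "inj_on (\<lambda>g. restrict g S) ?V"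
  proof
    fix g h assume *: "g \<in> ?V" "h \<in> ?V" "restrict g S = restrict h S"
    have "g - h \<in> Dir A" using * by (intro Hsp_diff_Dir) (auto simp: Ppol_def)
    moreover have "\<forall>s\<in>S. (g - h) s = 0"
      using fun_cong[OF *(3)] by (simp add: restrict_def) metis
    ultimately have "g - h = 0" using assms(3) by (auto simp: determining_def)
    then show "g = h" by simp
  qed
  have "(\<lambda>g. restrict g S) ` ?V \<subseteq> PiE S K"
  proof clarify
    fix g assume g: "g \<in> Ppol d A" "Dir (Apairs d g) = {0}"
    have gD: "g \<in> Delta d" "g \<in> Hsp d A" using g Ppol_eq[OF assms(1,2)] by auto
    have "g s \<in> K s" for s
    proof -
      obtain k where k: "2 * g s = of_int k"
        using vertex_half_integral[OF assms(1) g(2), of s] by (elim Ints_cases)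
      have "{s, p s} \<in> A" using p f Apairs_iff[OF assms(1)] by blast
      then have "g s + g (p s) = d s (p s)" using gD by (auto simp: Hsp_def)
      then have "g s \<le> d s (p s)" "0 \<le> g s" using Delta_nonneg[OF assms(1) gD(1)] by (smt (verit))+
      then have "k \<le> \<lceil>2 * d s (p s)\<rceil>" "0 \<le> k" using k by linarith+
      then show ?thesis using k by (auto simp: K_def intro!: image_eqI[of _ _ k])
    qed
    then show "restrict g S \<in> PiE S K" by auto
  qed
  moreover have "finite (PiE S K)" using fS by (intro finite_PiE) (auto simp: K_def)
  ultimately show ?thesis using inj finite_imageD finite_subset by blast
qed

text \<open>Moving from \<open>g\<close> both ways along a direction until a new pair becomes tight
  lowers the dimension; \<open>g\<close> lies between the two exit points.\<close>

lemma Ppol_subset_hull: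
  assumes "int_metric d" "A \<in> scrA d" "determining S (Dir A)" "Dir A \<subseteq> span B" "finite B"
    and "g \<in> Ppol d A"
  shows "g \<in> convex hull {g \<in> Ppol d A. Dir (Apairs d g) = {0}}" (is "g \<in> convex hull ?V")
  using assms(6)
proof (induction "dim (Dir (Apairs d g))" arbitrary: g rule: less_induct)
  case less
  obtain f where f: "f \<in> Eprime d" "A = Apairs d f" using assms by (auto simp: scrA_def)
  have g: "g \<in> Eprime d" "g \<in> Delta d" "A \<subseteq> Apairs d g"
    using less.prems Ppol_Apairs[OF assms(1) f(1)] f(2) by (auto simp: Ppol_def)
  have detg: "determining S (Dir (Apairs d g))"
    using determining_mono[OF assms(3) Dir_antimono[OF g(3)]] .
  show ?case
  proof (cases "Dir (Apairs d g) = {0}")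
    case True
    then show ?thesis using less.prems by (intro hull_inc) simp
  next
    case False
    then obtain v where v: "v \<in> Dir (Apairs d g)" "v \<noteq> 0"
      using subspace_0[OF subspace_Dir] by blast
    have step: "\<exists>t>0. g + t *\<^sub>R w \<in> convex hull ?V"
      if w: "w \<in> Dir (Apairs d g)" "w \<noteq> 0" for w
    proof -
      obtain t where t: "t > 0" "g + t *\<^sub>R w \<in> Delta d"
        "Apairs d g \<subseteq> Apairs d (g + t *\<^sub>R w)" "w \<notin> Dir (Apairs d (g + t *\<^sub>R w))"
        using ray_exit[OF assms(1) g(1) detg w] by metis
      have "dim (Dir (Apairs d (g + t *\<^sub>R w))) < dim (Dir (Apairs d g))"
      proof (rule dim_strict_mono[OF subspace_Dir subspace_Dir _ _ assms(5)])
        show "Dir (Apairs d (g + t *\<^sub>R w)) \<subset> Dir (Apairs d g)"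
          using Dir_antimono[OF t(3)] t(4) w(1) by blast
        show "Dir (Apairs d g) \<subseteq> span B" using Dir_antimono[OF g(3)] assms(4) by blast
      qed
      moreover have "g + t *\<^sub>R w \<in> Ppol d A"
        using t g Ppol_Apairs[OF assms(1) f(1)] f(2) by auto
      ultimately show ?thesis using less.hyps t(1) by blast
    qed
    obtain t where t: "t > 0" "g + t *\<^sub>R v \<in> convex hull ?V" using step v by blast
    obtain s where s: "s > 0" "g + s *\<^sub>R (- v) \<in> convex hull ?V"
      using step[of "- v"] v subspace_neg[OF subspace_Dir v(1)] by auto
    \<comment> \<open>These weights make the displacements \<open>t *\<^sub>R v\<close> and
      \<open>s *\<^sub>R (- v)\<close> cancel.\<close>
    have "(s / (s + t)) *\<^sub>R (g + t *\<^sub>R v) + (t / (s + t)) *\<^sub>R (g + s *\<^sub>R (- v)) \<in> convex hull ?V"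
      using t s by (intro convexD[OF convex_convex_hull]) (auto simp flip: add_divide_distrib)
    also have "(s / (s + t)) *\<^sub>R (g + t *\<^sub>R v) + (t / (s + t)) *\<^sub>R (g + s *\<^sub>R (- v))
      = (s / (s + t) + t / (s + t)) *\<^sub>R g"
      by (simp add: algebra_simps)
    also have "s / (s + t) + t / (s + t) = 1" using s t by (simp flip: add_divide_distrib)
    finally show ?thesis by (simp only: scaleR_one)
  qed
qed

lemma polytope_Ppol:
  assumes "int_metric d" "A \<in> scrA d" "determining S (Dir A)" "Dir A \<subseteq> span B" "finite B"
  shows "polytope (Ppol d A)"
proof -
  let ?V = "{g \<in> Ppol d A. Dir (Apairs d g) = {0}}"
  have "convex hull ?V \<subseteq> Ppol d A"
    using convex_Ppol[OF assms(1,2)] by (intro hull_minimal) auto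
  then have "Ppol d A = convex hull ?V" using Ppol_subset_hull[OF assms] by blast
  then show ?thesis unfolding polytope_def using finite_vertices[OF assms(1-3)] by blast
qed

section \<open>Dimension\<close>

text \<open>From the generating point \<open>f\<close> one can move a little along every direction
  without leaving the polytope, so its differences span all of \<open>Dir A\<close>.\<close>

lemma affdim_Ppol:
  assumes "int_metric d" "f \<in> Eprime d" "A = Apairs d f" "determining S (Dir A)"
  shows "affdim (Ppol d A) = affdim (Hsp d A)"
proof -
  have fH: "f \<in> Hsp d A" by (simp add: assms(3) Hsp_Apairs_iff[OF assms(1)])
  have fD: "f \<in> Delta d" using assms by (simp add: Eprime_def)
  have eq: "Ppol d A = Delta d \<inter> Hsp d A" using assms by (intro Ppol_eq) (auto simp: scrA_def)
  let ?E = "{g - h | g h. g \<in> Ppol d A \<and> h \<in> Ppol d A}"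
  have "?E \<subseteq> Dir A" using Hsp_differences[OF fH] eq by blast
  moreover have "v \<in> span ?E" if v: "v \<in> Dir A" for v
  proof -
    obtain \<delta> where de: "\<delta> > 0" "\<And>t. \<bar>t\<bar> \<le> \<delta> \<Longrightarrow> f + t *\<^sub>R v \<in> Delta d"
      using Delta_wiggle[OF assms(1) fD] assms(3,4) v by metis
    have "f + \<delta> *\<^sub>R v \<in> Ppol d A" "f \<in> Ppol d A"
      using de eq fD fH Hsp_add_Dir[OF fH] subspace_scale[OF subspace_Dir v] by auto
    then have "(f + \<delta> *\<^sub>R v) - f \<in> ?E" by blast
    then have "(1 / \<delta>) *\<^sub>R (\<delta> *\<^sub>R v) \<in> span ?E" by (intro span_scale span_base) simp
    then show ?thesis using de(1) by simp
  qed
  ultimately have "span ?E = Dir A"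
    using span_minimal[OF _ subspace_Dir] by blast
  then have "dim ?E = dim (Dir A)" using dim_span[of ?E] by simp
  then show ?thesis by (simp add: affdim_def Hsp_differences[OF fH])
qed

section \<open>Sup-distance and injectivity\<close>

lemma supdist_le: "(\<And>x. \<bar>g x - h x\<bar> \<le> c) \<Longrightarrow> supdist g h \<le> c"
  unfolding supdist_def by (rule cSUP_least) auto

text \<open>Finite rank bounds the differences, which makes the supremum in \<open>supdist\<close> a
  genuine upper bound.\<close>

lemma supdist_ge:
  assumes "determining S (Dir A)" "g \<in> Hsp d A" "h \<in> Hsp d A"
  shows "\<bar>g x - h x\<bar> \<le> supdist g h"
proof -
  obtain M where "\<And>x. \<bar>(g - h) x\<bar> \<le> M"
    using Dir_bounded[OF assms(1) Hsp_diff_Dir[OF assms(2,3)]] by metis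
  then have "bdd_above (range (\<lambda>x. \<bar>g x - h x\<bar>))" by (auto simp: bdd_above_def)
  then show ?thesis unfolding supdist_def by (rule cSUP_upper2) auto
qed

text \<open>The smallest and largest 1-Lipschitz extensions \<open>a\<close> and \<open>b\<close>, taken coordinatewise, satisfy \<open>a p + b q \<ge> d p q\<close>, with equality on \<open>A\<close>; hence their mean lies in the polytope.\<close>
lemma injective_Delta_Hsp:
  assumes "determining S (Dir A)" "Delta d \<inter> Hsp d A \<noteq> {}" "int_metric d"
  shows "injective_ms TYPE('b) (Delta d \<inter> Hsp d A) supdist"
  unfolding injective_ms_def
proof (intro allI impI, elim conjE)
  fix Y :: "'b set" and e Z and \<phi> :: "'b \<Rightarrow> 'a \<Rightarrow> real"
  assume Y: "Metric_space Y e" and ZY: "Z \<subseteq> Y" and im: "\<phi> ` Z \<subseteq> Delta d \<inter> Hsp d A"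
    and lip: "\<forall>x\<in>Z. \<forall>y\<in>Z. supdist (\<phi> x) (\<phi> y) \<le> e x y"
  interpret Metric_space Y e by fact
  show "\<exists>\<psi>. \<psi> ` Y \<subseteq> Delta d \<inter> Hsp d A \<and> (\<forall>x\<in>Z. \<psi> x = \<phi> x) \<and>
    (\<forall>x\<in>Y. \<forall>y\<in>Y. supdist (\<psi> x) (\<psi> y) \<le> e x y)"
  proof (cases "Z = {}")
    case True
    \<comment> \<open>Suprema and infima over an empty \<open>Z\<close> carry no information; a
      constant map serves here.\<close>
    obtain f where "f \<in> Delta d \<inter> Hsp d A" using assms(2) by blast
    then show ?thesis using True
      by (intro exI[of _ "\<lambda>_. f"]) (auto intro: supdist_le)
  next
    case False
    have lip': "\<phi> z p \<le> \<phi> w p + e z w" if "z \<in> Z" "w \<in> Z" for z w p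
    proof -
      have "\<bar>\<phi> z p - \<phi> w p\<bar> \<le> supdist (\<phi> z) (\<phi> w)"
        using im that by (intro supdist_ge[OF assms(1), of _ d]) auto
      then show ?thesis using lip that by fastforce
    qed
    have tri: "\<phi> z p - e y z \<le> \<phi> w p + e y w" if "z \<in> Z" "w \<in> Z" "y \<in> Y" for z w p y
    proof -
      have "e z w \<le> e y z + e y w" using triangle[of z y w] ZY that commute[of y z] by auto
      then show ?thesis using lip'[OF that(1,2)] by (smt (verit))
    qed
    define a where "a y p = (SUP z\<in>Z. \<phi> z p - e y z)" for y p
    define b where "b y p = (INF z\<in>Z. \<phi> z p + e y z)" for y p
    obtain z0 where z0: "z0 \<in> Z" using False by blast
    have bdA: "bdd_above ((\<lambda>z. \<phi> z p - e y z) ` Z)" if "y \<in> Y" for y p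
      using tri[OF _ z0 that] by (auto simp: bdd_above_def)
    have bdB: "bdd_below ((\<lambda>z. \<phi> z p + e y z) ` Z)" if "y \<in> Y" for y p
      using tri[OF z0 _ that] by (auto simp: bdd_below_def)
    have aU: "\<phi> z p - e y z \<le> a y p" if "z \<in> Z" "y \<in> Y" for z p y
      unfolding a_def using that by (intro cSUP_upper bdA)
    have bL: "b y p \<le> \<phi> z p + e y z" if "z \<in> Z" "y \<in> Y" for z p y
      unfolding b_def using that by (intro cINF_lower bdB)
    have aL: "a y p \<le> c" if "\<And>z. z \<in> Z \<Longrightarrow> \<phi> z p - e y z \<le> c" for y p c
      unfolding a_def using that False by (intro cSUP_least)
    have bU: "c \<le> b y p" if "\<And>z. z \<in> Z \<Longrightarrow> c \<le> \<phi> z p + e y z" for y p c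
      unfolding b_def using that False by (intro cINF_greatest)
    have ab: "d p q \<le> a y p + b y q" if "y \<in> Y" for p q y
    proof -
      have "d p q - a y p \<le> b y q"
      proof (rule bU)
        fix z assume z: "z \<in> Z"
        have "d p q \<le> \<phi> z p + \<phi> z q" using im z by (auto simp: Delta_iff)
        then show "d p q - a y p \<le> \<phi> z q + e y z" using aU[OF z that, of p] by simp
      qed
      then show ?thesis by simp
    qed
    have ab': "a y p + b y q \<le> d p q" if "y \<in> Y" "{p, q} \<in> A" for p q y
    proof -
      have "a y p \<le> d p q - b y q"
      proof (rule aL)
        fix z assume z: "z \<in> Z"
        have "\<phi> z p + \<phi> z q = d p q" using im z that(2) by (auto simp: Hsp_def)
        then show "\<phi> z p - e y z \<le> d p q - b y q" using bL[OF z that(1), of q] by simp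
      qed
      then show ?thesis by simp
    qed
    define \<psi> where "\<psi> y p = (a y p + b y p) / 2" for y p
    have "\<psi> y \<in> Delta d \<inter> Hsp d A" if y: "y \<in> Y" for y
    proof -
      \<comment> \<open>Adding the estimates for \<open>(p, q)\<close> and \<open>(q, p)\<close>
        symmetrizes the roles of \<open>a\<close> and \<open>b\<close>.\<close>
      have "d p q \<le> \<psi> y p + \<psi> y q" for p q
        using ab[OF y, of p q] ab[OF y, of q p] int_metric_sym[OF assms(3), of p q]
        by (simp add: \<psi>_def field_simps)
      moreover have "\<psi> y p + \<psi> y q \<le> d p q" if "{p, q} \<in> A" for p q
        using ab'[OF y that] ab'[OF y, of q p] that int_metric_sym[OF assms(3), of p q]
        by (simp add: \<psi>_def field_simps insert_commute)
      ultimately show ?thesis by (simp add: Delta_iff Hsp_def order_antisym)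
    qed
    moreover have "\<psi> z = \<phi> z" if z: "z \<in> Z" for z
    proof
      fix p
      have zY: "z \<in> Y" "e z z = 0" using z ZY by auto
      \<comment> \<open>At points of \<open>Z\<close> both envelopes agree with
        \<open>\<phi>\<close>, so their mean does too.\<close>
      have "a z p \<le> \<phi> z p" using lip'[OF _ z] commute by (intro aL) (simp add: diff_le_eq)
      moreover have "\<phi> z p \<le> b z p" using lip'[OF z] by (intro bU)
      ultimately show "\<psi> z p = \<phi> z p"
        using aU[OF z zY(1), of p] bL[OF z zY(1), of p] zY(2) by (simp add: \<psi>_def)
    qed
    moreover have "supdist (\<psi> x) (\<psi> y) \<le> e x y" if xy: "x \<in> Y" "y \<in> Y" for x y
    proof (rule supdist_le)
      fix p
      \<comment> \<open>One-sided Lipschitz bounds of both envelopes; exchanging \<open>u\<close>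
        and \<open>w\<close> yields the absolute value.\<close>
      have L: "a u p \<le> a w p + e u w \<and> b u p \<le> b w p + e u w" if uw: "u \<in> Y" "w \<in> Y" for u w
      proof
        show "a u p \<le> a w p + e u w"
        proof (rule aL)
          fix z assume z: "z \<in> Z"
          have "e w z \<le> e u w + e u z" using triangle[of w u z] commute[of u w] uw z ZY by auto
          then show "\<phi> z p - e u z \<le> a w p + e u w" using aU[OF z uw(2), of p] by simp
        qed
        have "b u p - e u w \<le> b w p"
        proof (rule bU)
          fix z assume z: "z \<in> Z"
          have "e u z \<le> e u w + e w z" using triangle[of u w z] uw z ZY by auto
          then show "b u p - e u w \<le> \<phi> z p + e w z" using bL[OF z uw(1), of p] by simp
        qed
        then show "b u p \<le> b w p + e u w" by simp
      qed
      show "\<bar>\<psi> x p - \<psi> y p\<bar> \<le> e x y"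
        using L[OF xy] L[OF xy(2,1)] commute[of x y] by (auto simp: \<psi>_def abs_le_iff field_simps)
    qed
    ultimately show ?thesis by (intro exI[of _ \<psi>]) blast
  qed
qed

section \<open>Relative interior\<close>

lemma Ppol_rel_int:
  assumes "int_metric d" "f \<in> Eprime d" "A = Apairs d f" "determining S (Dir A)"
  shows "rel_int_in supdist (Hsp d A) (Ppol d A) = {g \<in> Eprime d. Apairs d g = A}"
proof (intro equalityI subsetI)
  have fH: "f \<in> Hsp d A" by (simp add: assms(3) Hsp_Apairs_iff[OF assms(1)])
  have eq: "Ppol d A = Delta d \<inter> Hsp d A" using assms by (intro Ppol_eq) (auto simp: scrA_def)
  fix g assume "g \<in> rel_int_in supdist (Hsp d A) (Ppol d A)"
  then obtain \<epsilon> where g: "g \<in> Ppol d A" and e: "\<epsilon> > 0"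
    "\<And>h. h \<in> Hsp d A \<Longrightarrow> supdist g h < \<epsilon> \<Longrightarrow> h \<in> Ppol d A"
    by (auto simp: rel_int_in_def)
  have v: "g - f \<in> Dir A" using g fH by (intro Hsp_diff_Dir) (auto simp: Ppol_def)
  obtain M where M: "M > 0" "\<And>x. \<bar>(g - f) x\<bar> \<le> M" using Dir_bounded[OF assms(4) v] by metis
  \<comment> \<open>Prolongs the segment from \<open>f\<close> through \<open>g\<close> by a
    sup-distance of at most \<open>\<epsilon> / 2\<close>, hence inside the given ball.\<close>
  define \<delta> where "\<delta> = \<epsilon> / (2 * M)"
  have d0: "\<delta> > 0" using M e by (simp add: \<delta>_def)
  define h where "h = g + \<delta> *\<^sub>R (g - f)"
  have "supdist g h \<le> \<epsilon> / 2"
  proof (rule supdist_le)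
    fix x
    have "\<delta> * \<bar>(g - f) x\<bar> \<le> \<delta> * M" using M d0 by (intro mult_left_mono) auto
    also have "\<delta> * M = \<epsilon> / 2" using M by (simp add: \<delta>_def)
    finally show "\<bar>g x - h x\<bar> \<le> \<epsilon> / 2" using d0 by (simp add: h_def scaleR_fun_def abs_mult)
  qed
  moreover have "h \<in> Hsp d A"
    unfolding h_def using g v by (intro Hsp_add_Dir subspace_scale[OF subspace_Dir]) (auto simp: Ppol_def)
  ultimately have hP: "h \<in> Delta d" using e eq by force
  have "{x, y} \<in> A" if xy: "g x + g y = d x y" for x y
  proof -
    have "d x y \<le> h x + h y" using hP by (simp add: Delta_iff)
    \<comment> \<open>A pair tight at \<open>g\<close> but slack at \<open>f\<close> would be
      violated beyond \<open>g\<close>.\<close>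
    also have "h x + h y = d x y + \<delta> * (d x y - (f x + f y))"
      using xy by (simp add: h_def scaleR_fun_def algebra_simps flip: xy)
    finally have "0 \<le> \<delta> * (d x y - (f x + f y))" by simp
    then have "f x + f y \<le> d x y" using d0 by (simp add: zero_le_mult_iff)
    moreover have "d x y \<le> f x + f y" using assms(2) by (simp add: Eprime_def Delta_iff)
    ultimately show ?thesis using assms(3) Apairs_iff[OF assms(1)] by auto
  qed
  then have "Apairs d g \<subseteq> A" by (simp add: Apairs_subset_iff)
  then show "g \<in> {g \<in> Eprime d. Apairs d g = A}"
    using g Hsp_Apairs_iff[OF assms(1)] assms(3) by (auto simp: Ppol_def)
next
  have eq: "Ppol d A = Delta d \<inter> Hsp d A" using assms by (intro Ppol_eq) (auto simp: scrA_def)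
  fix g assume "g \<in> {g \<in> Eprime d. Apairs d g = A}"
  then have g: "g \<in> Delta d" "g \<in> Eprime d" "Apairs d g = A" by (auto simp: Eprime_def)
  have gH: "g \<in> Hsp d A" using g Hsp_Apairs_iff[OF assms(1)] by blast
  obtain \<epsilon> where e: "\<epsilon> > 0" "\<And>v. v \<in> Dir A \<Longrightarrow> (\<forall>x. \<bar>v x\<bar> \<le> \<epsilon>) \<Longrightarrow> g + v \<in> Delta d"
    using Delta_interior[OF assms(1) g(1)] assms(4) g(3) by metis
  have "h \<in> Ppol d A" if h: "h \<in> Hsp d A" "supdist g h < \<epsilon>" for h
  proof -
    have "\<bar>(h - g) x\<bar> \<le> \<epsilon>" for x
      using supdist_ge[OF assms(4) gH h(1), of x] h(2) by (simp add: abs_minus_commute)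
    then have "g + (h - g) \<in> Delta d" using e(2)[OF Hsp_diff_Dir[OF h(1) gH]] by blast
    then show ?thesis using h eq by simp
  qed
  then show "g \<in> rel_int_in supdist (Hsp d A) (Ppol d A)"
    using e(1) eq g gH by (auto simp: rel_int_in_def)
qed

section \<open>Faces\<close>

text \<open>A pair tight at an inner point of a segment in \<open>Delta d\<close> is tight at both
  endpoints.\<close>

lemma Ppol_face_of:
  assumes "int_metric d" "A \<in> scrA d" "A' \<in> scrA d" "A \<subseteq> A'"
  shows "Ppol d A' face_of Ppol d A"
  unfolding face_of_def
proof (intro conjI ballI impI)
  show "Ppol d A' \<subseteq> Ppol d A" using assms(4) by (auto simp: Ppol_def Hsp_def)
  show "convex (Ppol d A')" using assms by (intro convex_Ppol)
  obtain f where f: "f \<in> Eprime d" "A' = Apairs d f" using assms by (auto simp: scrA_def)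
  fix g h k assume *: "g \<in> Ppol d A" "h \<in> Ppol d A" "k \<in> Ppol d A'" "k \<in> open_segment g h"
  obtain u where u: "0 < u" "u < 1" "k = (1 - u) *\<^sub>R g + u *\<^sub>R h"
    using *(4) by (auto simp: in_segment)
  have D: "g \<in> Delta d" "h \<in> Delta d" using * Ppol_eq assms by auto
  have "A' \<subseteq> Apairs d g \<inter> Apairs d h"
    using Apairs_convex_combination[OF assms(1) D u(1,2)] *(3) u(3)
      Ppol_Apairs[OF assms(1) f(1)] f(2) by auto
  then show "g \<in> Ppol d A'" "h \<in> Ppol d A'"
    using D Ppol_Apairs[OF assms(1) f(1)] f(2) by auto
qed

text \<open>Take \<open>f\<close> in \<open>F\<close> with direction space of maximal dimension. Its
  tight pairs are tight on all of \<open>F\<close>. Conversely, any other point of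
  \<open>Ppol d (Apairs d f)\<close> is the end of a segment in \<open>Ppol d A\<close> with
  \<open>f\<close> in its interior, so the face property puts it in \<open>F\<close>.\<close>

lemma face_of_Ppol:
  assumes "int_metric d" "A \<in> scrA d" "determining S (Dir A)" "Dir A \<subseteq> span B" "finite B"
    and "F face_of Ppol d A" "F \<noteq> {}"
  shows "\<exists>f\<in>Eprime d. A \<subseteq> Apairs d f \<and> F = Ppol d (Apairs d f)"
proof -
  obtain f0 where f0: "f0 \<in> Eprime d" "A = Apairs d f0" using assms by (auto simp: scrA_def)
  have FP: "F \<subseteq> Ppol d A" and cF: "convex F" using assms(6) by (auto simp: face_of_def)
  have P: "g \<in> Eprime d" "g \<in> Delta d" "A \<subseteq> Apairs d g" if "g \<in> F" for g
    using that FP Ppol_Apairs[OF assms(1) f0(1)] f0(2) by (auto simp: Ppol_def)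
  have Dsub: "Dir (Apairs d g) \<subseteq> Dir A" if "g \<in> F" for g using Dir_antimono P(3)[OF that] .
  have lt: "dim (Dir (Apairs d g)) < dim (Dir (Apairs d h))"
    if "g \<in> F" "h \<in> F" "Dir (Apairs d g) \<subset> Dir (Apairs d h)" for g h
    using that Dsub assms(4,5) by (intro dim_strict_mono[where B = B] subspace_Dir) auto
  have dimle: "dim (Dir (Apairs d g)) \<le> card B" if "g \<in> F" for g
    using Dsub[OF that] assms(4,5) by (intro dim_le_card) auto
  obtain g0 where "g0 \<in> F" using assms(7) by blast
  then obtain f where f: "f \<in> F"
    "\<And>g. g \<in> F \<Longrightarrow> dim (Dir (Apairs d g)) \<le> dim (Dir (Apairs d f))"
    using ex_has_greatest_nat[of "\<lambda>g. g \<in> F" g0 "\<lambda>g. dim (Dir (Apairs d g))" "Suc (card B)"]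
      dimle by (auto simp: less_Suc_eq_le)
  have sub: "Apairs d f \<subseteq> Apairs d h" if h: "h \<in> F" for h
  proof (rule ccontr)
    assume "\<not> Apairs d f \<subseteq> Apairs d h"
    then obtain x y where xy: "f x + f y = d x y" "h x + h y \<noteq> d x y"
      using Apairs_subset_iff Apairs_iff[OF assms(1)] by metis
    \<comment> \<open>If a pair tight at \<open>f\<close> were slack at \<open>h\<close>, the
      midpoint would have fewer tight pairs and a strictly larger direction space.\<close>
    define m where "m = (1 - 1/2) *\<^sub>R f + (1/2) *\<^sub>R h"
    have mF: "m \<in> F" unfolding m_def using f(1) h by (intro convexD_alt[OF cF]) auto
    have Am: "Apairs d m = Apairs d f \<inter> Apairs d h"
      unfolding m_def using P f(1) h by (intro Apairs_convex_combination[OF assms(1)]) auto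
    have "m \<in> Hsp d (Apairs d m)" "f \<in> Hsp d (Apairs d m)"
      unfolding Hsp_Apairs_iff[OF assms(1)] using Am by auto
    then have "m - f \<in> Dir (Apairs d m)" by (rule Hsp_diff_Dir)
    moreover have "m - f \<notin> Dir (Apairs d f)"
    proof
      assume m: "m - f \<in> Dir (Apairs d f)"
      have "(m - f) x + (m - f) y = 0"
        using xy(1) by (intro DirD[OF m]) (simp add: Apairs_iff[OF assms(1)])
      then show False using xy by (simp add: m_def scaleR_fun_def)
    qed
    moreover have "Dir (Apairs d f) \<subseteq> Dir (Apairs d m)" using Am by (intro Dir_antimono) auto
    ultimately have "dim (Dir (Apairs d f)) < dim (Dir (Apairs d m))"
      using lt f(1) mF by blast
    then show False using f(2)[OF mF] by simp
  qed
  have fE: "f \<in> Eprime d" "f \<in> Delta d" using P f(1) by auto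
  have PA: "Ppol d (Apairs d f) = {g \<in> Delta d. Apairs d f \<subseteq> Apairs d g}"
    using Ppol_Apairs[OF assms(1) fE(1)] .
  have "g \<in> F" if g: "g \<in> Ppol d (Apairs d f)" for g
  proof (cases "g = f")
    case False
    have fH: "f \<in> Hsp d (Apairs d f)" by (simp add: Hsp_Apairs_iff[OF assms(1)])
    have gH: "g \<in> Hsp d (Apairs d f)" using g by (simp add: Ppol_def)
    have v: "f - g \<in> Dir (Apairs d f)" using Hsp_diff_Dir[OF fH gH] .
    obtain \<delta> where de: "\<delta> > 0" "\<And>t. \<bar>t\<bar> \<le> \<delta> \<Longrightarrow> f + t *\<^sub>R (f - g) \<in> Delta d"
      using Delta_wiggle[OF assms(1) fE(2) determining_mono[OF assms(3) Dsub[OF f(1)]] v] by metis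
    define h where "h = f + \<delta> *\<^sub>R (f - g)"
    have "h \<in> Hsp d (Apairs d f)"
      unfolding h_def using fH v by (intro Hsp_add_Dir subspace_scale[OF subspace_Dir])
    then have hP: "h \<in> Ppol d A" and gP: "g \<in> Ppol d A"
      using de g PA P(3)[OF f(1)] Ppol_Apairs[OF assms(1) f0(1)] f0(2) Hsp_Apairs_iff[OF assms(1)]
      by (auto simp: h_def)
    have "f \<in> open_segment g h"
      unfolding in_segment
    proof (intro conjI exI)
      \<comment> \<open>Measured from \<open>g\<close>, the prolonged point \<open>h\<close> is
        \<open>1 + \<delta>\<close> times as far away as \<open>f\<close>, whence the parameter
        \<open>1 / (1 + \<delta>)\<close>.\<close>
      have "h - g = (1 + \<delta>) *\<^sub>R (f - g)" by (simp add: h_def algebra_simps)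
      moreover have "(1 + \<delta>) *\<^sub>R (f - g) \<noteq> 0" using de(1) False by simp
      ultimately show "g \<noteq> h" by auto
      have "(1 / (1 + \<delta>)) *\<^sub>R (h - g) = f - g"
        using de(1) \<open>h - g = _\<close> by simp
      then show "f = (1 - 1 / (1 + \<delta>)) *\<^sub>R g + (1 / (1 + \<delta>)) *\<^sub>R h"
        by (simp add: algebra_simps)
    qed (use de(1) in auto)
    then show ?thesis using assms(6) hP gP f(1) unfolding face_of_def by blast
  qed (use f in simp)
  moreover have "F \<subseteq> Ppol d (Apairs d f)" using sub P PA by auto
  ultimately show ?thesis using fE P(3)[OF f(1)] by blast
qed

theorem theorem4p3:
  fixes d :: "'a \<Rightarrow> 'a \<Rightarrow> real" and A :: "'a set set" and n :: nat
  assumes "int_metric d"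
    and "A \<in> scrA d"
    and "fin_affdim (Hsp d A)"
    and "n = rk d A"
    and "1 \<le> n"
  shows "(polytope (Ppol d A) \<and> affdim (Ppol d A) = n
           \<and> injective_ms TYPE('b) (Ppol d A) supdist)
         \<and> rel_int_in supdist (Hsp d A) (Ppol d A) = {g \<in> Eprime d. Apairs d g = A}
         \<and> {F. F face_of Ppol d A \<and> F \<noteq> {}} = {Ppol d A' | A'. A' \<in> scrA d \<and> A \<subseteq> A'}"
proof -
  obtain f where f: "f \<in> Eprime d" "A = Apairs d f" using assms(2) by (auto simp: scrA_def)
  have fH: "f \<in> Hsp d A" by (simp add: f Hsp_Apairs_iff[OF assms(1)])
  obtain B where B: "finite B" "span B = span (Dir A)"
    using assms(3) unfolding fin_affdim_def Hsp_differences[OF fH] by blast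
  then have BD: "Dir A \<subseteq> span B" using span_superset by blast
  obtain S where S: "determining S (Dir A)"
    using finite_span_determining[OF B(1)] determining_mono[OF _ BD] by blast
  have eq: "Ppol d A = Delta d \<inter> Hsp d A" using Ppol_eq[OF assms(1,2)] .
  have "f \<in> Delta d" using f by (simp add: Eprime_def)
  then have inj: "injective_ms TYPE('b) (Ppol d A) supdist"
    unfolding eq using fH by (intro injective_Delta_Hsp[OF S _ assms(1)]) blast
  have "{F. F face_of Ppol d A \<and> F \<noteq> {}} = {Ppol d A' | A'. A' \<in> scrA d \<and> A \<subseteq> A'}" (is "?L = ?R")
  proof
    show "?L \<subseteq> ?R"
      using face_of_Ppol[OF assms(1,2) S BD B(1)] by (fastforce simp: scrA_def)
    \<comment> \<open>\<open>face_of\<close> admits the empty set, which is excluded on the left; on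
      the right, a function generating \<open>A'\<close> always lies in
      \<open>Ppol d A'\<close>.\<close>
    have "Ppol d A' \<noteq> {}" if "A' \<in> scrA d" for A'
      using that Hsp_Apairs_iff[OF assms(1)] by (auto simp: scrA_def Ppol_def)
    then show "?R \<subseteq> ?L" using Ppol_face_of[OF assms(1,2)] by blast
  qed
  then show ?thesis
    using polytope_Ppol[OF assms(1,2) S BD B(1)] affdim_Ppol[OF assms(1) f S] assms(4) inj
      Ppol_rel_int[OF assms(1) f S] by (simp add: rk_def)
qed

end
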